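(* Let $w^*\in\mathbb{R}^d$ be a solution to $\nabla P(w)=0$. Consider the iterates $x^k=(w^k;\alpha_1^k;\cdots;\alpha_n^k)$ of the Stochastic Newton Method (SNM), and let $x^*=(w^*;w^*;\cdots;w^* )\in\mathbb{R}^{(n+1)d}$. If there exists $\mu>0$ such that for all $x=(w;\alpha_1;\cdots;\alpha_n)$ and $x'$ in $\mathbb{R}^{(n+1)d}$ $$f_{x'}(x^* )\ge f_{x'}(x)+\langle\nabla f_{x'}(x),x^*-x\rangle+\frac\mu2\|x^*-x\|^2$$ $$=f_{x'}(x)+\langle\nabla f_{x'}(x),x^*-x\rangle+\frac\mu2\Big(\|w^*-w\|^2+\sum_{i=1}^n\|w^*-\alpha_i\|^2\Big),$$ then the iterates of SNM converge linearly according to $$\mathbb{E}\big[\|x^{k+1}-x^*\|^2\big]\le(1-\mu)^{k+1}\|x^0-x^*\|^2 .$$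
   Context: Let $P(w)=\frac1n\sum_{i=1}^n\phi_i(w)$, $w\in\mathbb{R}^d$, where each $\phi_i:\mathbb{R}^d\to\mathbb{R}$ is twice differentiable and strictly convex. SNM: fix $\tau\in\{1,\dots,n\}$ and initial $w^0,\alpha^0_1,\dots,\alpha^0_n\in\mathbb{R}^d$. At iteration $k$, draw a fresh subset $B_n\subset\{1,\dots,n\}$ with $|B_n|=\tau$ uniformly at random and set $$w^{k+1}=\Big(\frac1n\sum_{i=1}^n\nabla^2\phi_i(\alpha_i^k)\Big)^{-1}\Big(\frac1n\sum_{i=1}^n\nabla^2\phi_i(\alpha_i^k)\alpha_i^k-\frac1n\sum_{i=1}^n\nabla\phi_i(\alpha_i^k)\Big),$$ $\alpha_i^{k+1}=w^{k+1}$ if $i\in B_n$, and $\alpha_i^{k+1}=\alpha_i^k$ if $i\notin B_n$ (the inverse is understood to exist). For $x=(w;\alpha_1;\cdots;\alpha_n)\in\mathbb{R}^{(n+1)d}$ (stacked column vectors) define $$F(x)=\Big[\tfrac1n\sum_{i=1}^n\nabla\phi_i(\alpha_i)\,;\,w-\alpha_1\,;\,\cdots\,;\,w-\alpha_n\Big]\in\mathbb{R}^{(n+1)d},$$ and let $DF(x)\in\mathbb{R}^{(n+1)d\times(n+1)d}$ be the transpose of its Jacobian. $F$ is assumed continuously differentiable. For $x'=(w';\alpha_1';\cdots;\alpha_n')$, the distribution $\mathcal{D}_{x'}$ is that of the random matrix $$\mathbf{S}=\begin{bmatrix}\mathbf{I}_d&0\\ \mathbf{G}(x')&\mathbf{I}_{B_n}\end{bmatrix}\in\mathbb{R}^{(n+1)d\times(\tau+1)d},\qquad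 \mathbf{G}(x')=\begin{bmatrix}\frac1n\nabla^2\phi_1(\alpha_1')\\ \vdots\\ \frac1n\nabla^2\phi_n(\alpha_n')\end{bmatrix}\in\mathbb{R}^{nd\times d},$$ where $B_n$ is a uniformly random subset of size $\tau$ and $\mathbf{I}_{B_n}\in\mathbb{R}^{nd\times\tau d}$ is the concatenation of those of the $n$ consecutive $nd\times d$ column blocks of the identity $\mathbf{I}_{nd}$ whose indices lie in $B_n$. With $\dagger$ the Moore-Penrose pseudoinverse, let $\mathbf{H}_{\mathbf{S}}(x')=\mathbf{S}(\mathbf{S}^\top DF(x')^\top DF(x')\mathbf{S})^\dagger\mathbf{S}^\top$ and $$f_{x'}(x)=\tfrac12F(x)^\top\,\mathbb{E}_{\mathbf{S}\sim\mathcal{D}_{x'}}[\mathbf{H}_{\mathbf{S}}(x')]\,F(x),\qquad \nabla f_{x'}(x)=DF(x)\,\mathbb{E}_{\mathbf{S}\sim\mathcal{D}_{x'}}[\mathbf{H}_{\mathbf{S}}(x')]\,F(x)$$ (gradient in $x$ for fixed $x'$). $\|\cdot\|$ is the Euclidean norm. *)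

theory Defs
  imports "HOL-Analysis.Analysis" "HOL-Probability.Probability"
begin

section \<open>Calculus and linear algebra\<close>

definition grad :: "('a::real_inner \<Rightarrow> real) \<Rightarrow> 'a \<Rightarrow> 'a" where
  "grad f x = (THE D. GDERIV f x :> D)"

definition hessian :: "(real^'d \<Rightarrow> real) \<Rightarrow> real^'d \<Rightarrow> real^'d^'d" where
  "hessian f x = jacobian (grad f) (at x)"

definition twice_differentiable :: "(real^'d \<Rightarrow> real) \<Rightarrow> bool" where
  "twice_differentiable f \<longleftrightarrow>
     (\<forall>x. f differentiable (at x)) \<and> (\<forall>x. grad f differentiable (at x))"

definition strictly_convex :: "('a::real_vector \<Rightarrow> real) \<Rightarrow> bool" where
  "strictly_convex f \<longleftrightarrow>
     (\<forall>x y t. x \<noteq> y \<longrightarrow> 0 < t \<longrightarrow> t < 1 \<longrightarrow>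
        f ((1 - t) *\<^sub>R x + t *\<^sub>R y) < (1 - t) * f x + t * f y)"

text \<open>The four Penrose equations, which have exactly one solution for every real matrix.\<close>

definition pinv :: "real^'m^'n \<Rightarrow> real^'n^'m" where
  "pinv A = (THE X. A ** X ** A = A \<and> X ** A ** X = X \<and>
                    transpose (A ** X) = A ** X \<and> transpose (X ** A) = X ** A)"


section \<open>Stacked vectors and block matrices\<close>

text \<open>
  The number of functions is \<open>n = CARD('n)\<close> and the subset size is \<open>CARD('t)\<close>.  A vector of
  dimension \<open>(n + 1) d\<close> is indexed by pairs (block, coordinate): block \<open>None\<close> is \<open>w\<close>, block
  \<open>Some i\<close> is \<open>\<alpha>\<^sub>i\<close>.  The norm of this type is the Euclidean norm of the stacked column.
\<close>

type_synonym ('d, 'n) state = "real^('n option \<times> 'd)"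

definition stack :: "real^'d \<Rightarrow> ('n::finite \<Rightarrow> real^'d) \<Rightarrow> ('d, 'n) state" where
  "stack w \<alpha> = (\<chi> p. case p of (None, c) \<Rightarrow> w $ c | (Some i, c) \<Rightarrow> \<alpha> i $ c)"

definition w_part :: "('d::finite, 'n::finite) state \<Rightarrow> real^'d" where
  "w_part x = (\<chi> c. x $ (None, c))"

definition a_part :: "('d::finite, 'n::finite) state \<Rightarrow> 'n \<Rightarrow> real^'d" where
  "a_part x i = (\<chi> c. x $ (Some i, c))"

definition block_matrix :: "('r::finite \<Rightarrow> 's::finite \<Rightarrow> real^'d^'e) \<Rightarrow> real^('s \<times> 'd)^('r \<times> 'e)" where
  "block_matrix A = (\<chi> p q. A (fst p) (fst q) $ snd p $ snd q)"

lemma w_part_stack [simp]: "w_part (stack w \<alpha>) = w"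
  by (simp add: w_part_def stack_def vec_eq_iff)

lemma a_part_stack [simp]: "a_part (stack w \<alpha>) i = \<alpha> i"
  by (simp add: a_part_def stack_def vec_eq_iff)

lemma stack_parts [simp]: "stack (w_part x) (a_part x) = x"
  by (auto simp: w_part_def a_part_def stack_def vec_eq_iff split: option.split)

lemma norm_stack_diff:
  fixes w w' :: "real^'d" and \<alpha> \<alpha>' :: "'n::finite \<Rightarrow> real^'d"
  shows "(norm (stack w \<alpha> - stack w' \<alpha>'))\<^sup>2 =
           (norm (w - w'))\<^sup>2 + (\<Sum>i\<in>UNIV. (norm (\<alpha> i - \<alpha>' i))\<^sup>2)"
proof -
  have "(norm (stack w \<alpha> - stack w' \<alpha>'))\<^sup>2 =
      (\<Sum>p\<in>UNIV \<times> UNIV. ((stack w \<alpha> - stack w' \<alpha>') $ p)\<^sup>2)"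
    unfolding power2_norm_eq_inner inner_vec_def UNIV_Times_UNIV by (simp add: power2_eq_square)
  also have "\<dots> = (\<Sum>b\<in>UNIV. \<Sum>c\<in>UNIV. ((stack w \<alpha> - stack w' \<alpha>') $ (b, c))\<^sup>2)"
    by (simp add: sum.cartesian_product case_prod_beta)
  also have "\<dots> = (norm (w - w'))\<^sup>2 + (\<Sum>i\<in>UNIV. (norm (\<alpha> i - \<alpha>' i))\<^sup>2)"
    unfolding power2_norm_eq_inner inner_vec_def
    by (simp add: UNIV_option_conv sum.reindex stack_def power2_eq_square)
  finally show ?thesis .
qed


section \<open>The Stochastic Newton Method\<close>

definition avg_fun :: "('n::finite \<Rightarrow> real^'d \<Rightarrow> real) \<Rightarrow> real^'d \<Rightarrow> real" where
  "avg_fun \<phi> w = (1 / real CARD('n)) * (\<Sum>i\<in>UNIV. \<phi> i w)"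

definition avg_hessian :: "('n::finite \<Rightarrow> real^'d \<Rightarrow> real) \<Rightarrow> ('d, 'n) state \<Rightarrow> real^'d^'d" where
  "avg_hessian \<phi> x = (1 / real CARD('n)) *\<^sub>R (\<Sum>i\<in>UNIV. hessian (\<phi> i) (a_part x i))"

definition newton_point :: "('n::finite \<Rightarrow> real^'d \<Rightarrow> real) \<Rightarrow> ('d, 'n) state \<Rightarrow> real^'d" where
  "newton_point \<phi> x =
     matrix_inv (avg_hessian \<phi> x) *v
       ((1 / real CARD('n)) *\<^sub>R (\<Sum>i\<in>UNIV. hessian (\<phi> i) (a_part x i) *v a_part x i)
        - (1 / real CARD('n)) *\<^sub>R (\<Sum>i\<in>UNIV. grad (\<phi> i) (a_part x i)))"

definition snm_step ::
    "('n::finite \<Rightarrow> real^'d \<Rightarrow> real) \<Rightarrow> 'n set \<Rightarrow> ('d, 'n) state \<Rightarrow> ('d, 'n) state" where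
  "snm_step \<phi> B x =
     stack (newton_point \<phi> x) (\<lambda>i. if i \<in> B then newton_point \<phi> x else a_part x i)"

text \<open>The iterates along a given sequence \<open>B 0, B 1, \<dots>\<close> of sampled subsets.\<close>

primrec snm ::
    "('n::finite \<Rightarrow> real^'d \<Rightarrow> real) \<Rightarrow> ('d, 'n) state \<Rightarrow> (nat \<Rightarrow> 'n set) \<Rightarrow> nat \<Rightarrow> ('d, 'n) state"
where
  "snm \<phi> x0 B 0 = x0"
| "snm \<phi> x0 B (Suc k) = snm_step \<phi> (B k) (snm \<phi> x0 B k)"

definition uniform_subset :: "nat \<Rightarrow> 'n::finite set pmf" where
  "uniform_subset \<tau> = pmf_of_set {B. card B = \<tau>}"


section \<open>The sketched system\<close>

definition snm_F :: "('n::finite \<Rightarrow> real^'d \<Rightarrow> real) \<Rightarrow> ('d, 'n) state \<Rightarrow> ('d, 'n) state" where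
  "snm_F \<phi> x = stack ((1 / real CARD('n)) *\<^sub>R (\<Sum>i\<in>UNIV. grad (\<phi> i) (a_part x i)))
                 (\<lambda>i. w_part x - a_part x i)"

definition snm_DF :: "('n::finite \<Rightarrow> real^'d \<Rightarrow> real) \<Rightarrow> ('d, 'n) state
    \<Rightarrow> real^('n option \<times> 'd)^('n option \<times> 'd)" where
  "snm_DF \<phi> x = transpose (jacobian (snm_F \<phi>) (at x))"

text \<open>
  The increasing enumeration of \<open>B\<close>; it exists when \<open>card B = CARD('t)\<close>.  It lists the column
  blocks of the identity selected by \<open>B\<close> in their original order.
\<close>

definition enum_set :: "'n::{finite,linorder} set \<Rightarrow> 't::{finite,linorder} \<Rightarrow> 'n" where
  "enum_set B = (THE e. strict_mono e \<and> range e = B)"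

lemma enum_set:
  fixes B :: "'n::{finite,linorder} set"
  assumes "card B = CARD('t)"
  shows "strict_mono (enum_set B :: 't::{finite,linorder} \<Rightarrow> 'n)"
    and "range (enum_set B :: 't \<Rightarrow> 'n) = B"
proof -
  define l where "l = sorted_list_of_set B"
  define r where "r = (\<lambda>j::'t. card {..<j})"
  define e where "e = (\<lambda>j. l ! r j)"
  have len: "length l = CARD('t)" and dist: "sorted_wrt (<) l" and set_l: "set l = B"
    using assms strict_sorted_list_of_set[of B] by (simp_all add: l_def)
  have r_mono: "strict_mono r"
    unfolding r_def by (intro strict_monoI psubset_card_mono) auto
  have r_less: "r j < CARD('t)" for j
    unfolding r_def by (intro psubset_card_mono) auto
  have "strict_mono e"
    unfolding e_def using r_mono r_less len dist
    by (intro strict_monoI) (simp add: sorted_wrt_nth_less strict_monoD)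
  moreover have "range e = B"
  proof (rule card_subset_eq)
    show "range e \<subseteq> B"
      using r_less len set_l by (auto simp: e_def)
    show "card (range e) = card B"
      using assms \<open>strict_mono e\<close> by (simp add: card_image strict_mono_imp_inj_on)
  qed simp
  moreover have "e' = e" if "strict_mono e'" "range e' = B" for e' :: "'t \<Rightarrow> 'n"
  proof
    fix j
    have "e' i = e i" if "\<forall>i'<i. e' i' = e i'" for i
    proof -
      obtain i1 i2 where i: "e i1 = e' i" "e' i2 = e i"
        using \<open>range e = B\<close> \<open>range e' = B\<close> by (metis rangeE rangeI)
      have "\<not> i1 < i" "\<not> i2 < i"
        using that i \<open>strict_mono e\<close> \<open>strict_mono e'\<close> by (metis less_irrefl strict_mono_less)+
      then have "e i \<le> e' i" "e' i \<le> e i"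
        using i \<open>strict_mono e\<close> \<open>strict_mono e'\<close> by (metis not_less strict_mono_less_eq)+
      then show ?thesis by simp
    qed
    then show "e' j = e j"
      using strict_monoD[OF r_mono] by (induction j rule: measure_induct_rule[of r]) blast
  qed
  ultimately have "\<exists>!e. strict_mono (e :: 't \<Rightarrow> 'n) \<and> range e = B"
    by blast
  from theI'[OF this] show "strict_mono (enum_set B :: 't \<Rightarrow> 'n)"
      "range (enum_set B :: 't \<Rightarrow> 'n) = B"
    by (simp_all add: enum_set_def)
qed

definition sketch :: "('n::{finite,linorder} \<Rightarrow> real^'d \<Rightarrow> real) \<Rightarrow> ('d, 'n) state \<Rightarrow> 'n set
    \<Rightarrow> real^('t::{finite,linorder} option \<times> 'd)^('n option \<times> 'd)" where
  "sketch \<phi> x' B = block_matrix (\<lambda>r s. case (r, s) of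
       (None, None) \<Rightarrow> mat 1
     | (None, Some j) \<Rightarrow> 0
     | (Some i, None) \<Rightarrow> (1 / real CARD('n)) *\<^sub>R hessian (\<phi> i) (a_part x' i)
     | (Some i, Some j) \<Rightarrow> if i = enum_set B j then mat 1 else 0)"

definition sketch_distr :: "('n::{finite,linorder} \<Rightarrow> real^'d \<Rightarrow> real) \<Rightarrow> ('d, 'n) state
    \<Rightarrow> (real^('t::{finite,linorder} option \<times> 'd)^('n option \<times> 'd)) pmf" where
  "sketch_distr \<phi> x' = map_pmf (sketch \<phi> x') (uniform_subset CARD('t))"

definition snm_H :: "('n::finite \<Rightarrow> real^'d \<Rightarrow> real) \<Rightarrow> real^('t::finite option \<times> 'd)^('n option \<times> 'd)
    \<Rightarrow> ('d, 'n) state \<Rightarrow> real^('n option \<times> 'd)^('n option \<times> 'd)" where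
  "snm_H \<phi> S x' =
     S ** pinv (transpose S ** transpose (snm_DF \<phi> x') ** snm_DF \<phi> x' ** S) ** transpose S"

definition snm_EH :: "'t::{finite,linorder} itself \<Rightarrow> ('n::{finite,linorder} \<Rightarrow> real^'d \<Rightarrow> real)
    \<Rightarrow> ('d, 'n) state \<Rightarrow> real^('n option \<times> 'd)^('n option \<times> 'd)" where
  "snm_EH _ \<phi> x' = measure_pmf.expectation
     (sketch_distr \<phi> x' :: (real^('t option \<times> 'd)^('n option \<times> 'd)) pmf) (\<lambda>S. snm_H \<phi> S x')"

text \<open>
  Gradients of \<open>snm_f T \<phi> x'\<close> are taken in the last argument, with \<open>x'\<close> held fixed; when \<open>snm_F \<phi>\<close>
  is differentiable at \<open>x\<close> the gradient there is \<open>snm_DF \<phi> x *v (snm_EH T \<phi> x' *v snm_F \<phi> x)\<close>.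
\<close>

definition snm_f :: "'t::{finite,linorder} itself \<Rightarrow> ('n::{finite,linorder} \<Rightarrow> real^'d \<Rightarrow> real)
    \<Rightarrow> ('d, 'n) state \<Rightarrow> ('d, 'n) state \<Rightarrow> real" where
  "snm_f T \<phi> x' x = 1 / 2 * (snm_F \<phi> x \<bullet> (snm_EH T \<phi> x' *v snm_F \<phi> x))"

end

theory Submission
  imports Defs
begin

text \<open>
  One SNM step from \<open>z\<close> is the orthogonal projection of \<open>z\<close> onto the solutions of the sketched
  Newton system \<open>S\<^sup>T (DF\<^sup>T d + F) = 0\<close>: symmetry of the Hessians makes the first block row of
  \<open>S\<^sup>T DF\<^sup>T\<close> collapse to the averaged Hessian, and the remaining rows say \<open>\<alpha>\<^sub>i = w\<close> for the
  sampled \<open>i\<close>.  Hence the mean displacement is \<open>- \<nabla>f\<^sub>z(z)\<close> and the mean squared length of the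
  displacement is \<open>2 f\<^sub>z(z)\<close>, so expanding the square and inserting the convexity hypothesis
  at \<open>x = x' = z\<close>, where \<open>f\<^sub>z(x\<^sup>*) = 0\<close>, contracts the expected squared error by \<open>1 - \<mu>\<close>.
  Independence of the samples lets this be applied conditionally on the past, which takes only
  finitely many values.
\<close>

section \<open>Gradients and Hessians\<close>

text \<open>Schwarz's theorem, with the gradient differentiable at the single point
  \<open>x\<close>. The mixed second difference \<open>\<Delta> u v t\<close> is symmetric in
  \<open>u\<close> and \<open>v\<close>, and divided by the square of \<open>t\<close> it tends to
  \<open>g' v \<bullet> u\<close>.\<close>

lemma derivative_of_gradient_symmetric:
  fixes f :: "'a::real_inner \<Rightarrow> real"
  assumes f: "\<And>y. GDERIV f y :> g y" and g: "(g has_derivative g') (at x)"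
  shows "g' u \<bullet> v = g' v \<bullet> u"
proof -
  interpret g': bounded_linear g'
    using g by (rule has_derivative_bounded_linear)
  define \<Delta> where "\<Delta> u v t = f (x + t *\<^sub>R u + t *\<^sub>R v) - f (x + t *\<^sub>R u) - f (x + t *\<^sub>R v) + f x"
    for u v :: 'a and t :: real
  have \<Delta>_approx: "\<bar>\<Delta> u v t - t\<^sup>2 * (g' v \<bullet> u)\<bar> \<le> t\<^sup>2 * (2 * e * (norm u + norm v)\<^sup>2)"
    if t: "0 < t" "t * (norm u + norm v) < d" and e: "0 < e"
      and d: "\<And>y. norm (y - x) < d \<Longrightarrow> norm (g y - g x - g' (y - x)) \<le> e * norm (y - x)"
    for u v t d e
  proof -
    \<comment> \<open>Fixing the step \<open>t\<close> along \<open>v\<close> and varying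
      \<open>s\<close> along \<open>u\<close> gives
      \<open>\<Delta> u v t = \<psi> t - \<psi> 0\<close>, which calls for the mean value
      theorem.\<close>
    define \<psi> where "\<psi> s = f (x + s *\<^sub>R u + t *\<^sub>R v) - f (x + s *\<^sub>R u)" for s
    have deriv: "(\<psi> has_derivative (\<lambda>h. h * ((g (x + s *\<^sub>R u + t *\<^sub>R v) - g (x + s *\<^sub>R u)) \<bullet> u)))
        (at s within {0..t})" for s
    proof -
      have "(f has_derivative (\<lambda>h. h \<bullet> g y)) (at y)" for y
        using f[of y] by (simp add: gderiv_def)
      then have f': "((\<lambda>s. f (c s)) has_derivative (\<lambda>h. c' h \<bullet> g (c s))) (at s within {0..t})"
        if "(c has_derivative c') (at s within {0..t})" for c c'
        using has_derivative_compose[OF that] by blast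
      show ?thesis
        unfolding \<psi>_def
        by (rule has_derivative_eq_rhs, (rule derivative_intros f')+)
          (simp add: fun_eq_iff inner_diff_left inner_commute algebra_simps)
    qed
    obtain \<xi> where \<xi>: "\<xi> \<in> {0<..<t}"
      and mvt: "\<psi> t - \<psi> 0 = t * ((g (x + \<xi> *\<^sub>R u + t *\<^sub>R v) - g (x + \<xi> *\<^sub>R u)) \<bullet> u)"
      using mvt_simple[of 0 t \<psi>, OF \<open>0 < t\<close> deriv] by auto
    \<comment> \<open>The mean value theorem compares \<open>g\<close> at \<open>x + a\<close> and
      \<open>x + b\<close>. Both points lie within \<open>d\<close> of \<open>x\<close>, so both
      linearisation errors are controlled; as \<open>a - b = t *\<^sub>R v\<close>, the linear parts
      differ by \<open>t *\<^sub>R g' v\<close>.\<close>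
    define a b where "a = \<xi> *\<^sub>R u + t *\<^sub>R v" and "b = \<xi> *\<^sub>R u"
    have ab: "norm a \<le> t * (norm u + norm v)" "norm b \<le> t * (norm u + norm v)"
    proof -
      have "norm (\<xi> *\<^sub>R u) \<le> t * norm u"
        using \<xi> by (simp add: mult_right_mono)
      moreover have "norm a \<le> norm (\<xi> *\<^sub>R u) + t * norm v"
        unfolding a_def using norm_triangle_ineq[of "\<xi> *\<^sub>R u" "t *\<^sub>R v"] t by simp
      moreover have "0 \<le> t * norm v"
        using t by simp
      ultimately show "norm a \<le> t * (norm u + norm v)" "norm b \<le> t * (norm u + norm v)"
        by (simp_all add: b_def distrib_left)
    qed
    have "norm (g (x + c) - g x - g' c) \<le> e * (t * (norm u + norm v))"
      if "norm c \<le> t * (norm u + norm v)" for c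
      using d[of "x + c"] that t e by (smt (verit) add_diff_cancel_left' mult_left_mono)
    from this[OF ab(1)] this[OF ab(2)]
    have "norm ((g (x + a) - g x - g' a) - (g (x + b) - g x - g' b)) \<le> 2 * e * t * (norm u + norm v)"
      using norm_triangle_ineq4[of "g (x + a) - g x - g' a" "g (x + b) - g x - g' b"] by linarith
    moreover have "(g (x + a) - g x - g' a) - (g (x + b) - g x - g' b)
        = g (x + a) - g (x + b) - t *\<^sub>R g' v"
      by (simp add: a_def b_def g'.add g'.scaleR)
    ultimately have "norm (g (x + a) - g (x + b) - t *\<^sub>R g' v) \<le> 2 * e * t * (norm u + norm v)"
      by simp
    then have "\<bar>(g (x + a) - g (x + b) - t *\<^sub>R g' v) \<bullet> u\<bar> \<le> 2 * e * t * (norm u + norm v) * norm u"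
      by (meson Cauchy_Schwarz_ineq2 mult_right_mono norm_ge_zero order_trans)
    also have "\<dots> \<le> 2 * e * t * (norm u + norm v) * (norm u + norm v)"
      using t e by (intro mult_left_mono) auto
    finally have "t * \<bar>(g (x + a) - g (x + b) - t *\<^sub>R g' v) \<bullet> u\<bar> \<le> t * (2 * e * t * (norm u + norm v)\<^sup>2)"
      using t by (intro mult_left_mono) (auto simp: power2_eq_square algebra_simps)
    moreover have "\<Delta> u v t = t * ((g (x + a) - g (x + b)) \<bullet> u)"
      using mvt by (simp add: \<Delta>_def \<psi>_def a_def b_def algebra_simps)
    then have "\<Delta> u v t - t\<^sup>2 * (g' v \<bullet> u) = t * ((g (x + a) - g (x + b) - t *\<^sub>R g' v) \<bullet> u)"
      by (simp add: inner_diff_left power2_eq_square algebra_simps)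
    then have "\<bar>\<Delta> u v t - t\<^sup>2 * (g' v \<bullet> u)\<bar> = t * \<bar>(g (x + a) - g (x + b) - t *\<^sub>R g' v) \<bullet> u\<bar>"
      using t by (simp add: abs_mult)
    ultimately show ?thesis
      by (simp add: power2_eq_square mult_ac)
  qed
  define N where "N = (norm u + norm v)\<^sup>2"
  have bound: "\<bar>g' u \<bullet> v - g' v \<bullet> u\<bar> \<le> 4 * e * N" if e: "0 < e" for e
  proof -
    obtain d where "d > 0"
      and d: "\<And>y. norm (y - x) < d \<Longrightarrow> norm (g y - g x - g' (y - x)) \<le> e * norm (y - x)"
      using g e unfolding has_derivative_at_alt by blast
    \<comment> \<open>The added 1 keeps the denominator positive when \<open>u = v = 0\<close> and
      makes \<open>t * (norm u + norm v) < d\<close> strict.\<close>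
    define t where "t = d / (norm u + norm v + 1)"
    have pos: "norm u + norm v + 1 > 0"
      by (simp add: add_nonneg_pos)
    then have t: "0 < t" "t * (norm u + norm v) < d"
      using \<open>d > 0\<close> by (simp_all add: t_def field_simps)
    then have t': "t * (norm v + norm u) < d"
      by (simp add: add.commute)
    \<comment> \<open>One quantity approximates both mixed derivatives, each up to
      \<open>2 * e * N\<close> after division by the square of \<open>t\<close>; the two errors add
      up to \<open>4 * e * N\<close>.\<close>
    have "\<Delta> v u t = \<Delta> u v t"
      by (simp add: \<Delta>_def add_ac)
    then have "\<bar>t\<^sup>2 * (g' u \<bullet> v) - t\<^sup>2 * (g' v \<bullet> u)\<bar> \<le> t\<^sup>2 * (4 * e * N)"
      using \<Delta>_approx[OF t e d] \<Delta>_approx[OF t(1) t' e d]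
      by (simp add: N_def add.commute[of "norm v"])
    then have "t\<^sup>2 * \<bar>g' u \<bullet> v - g' v \<bullet> u\<bar> \<le> t\<^sup>2 * (4 * e * N)"
      by (simp add: right_diff_distrib[symmetric] abs_mult)
    then show ?thesis
      using t by simp
  qed
  have "\<bar>g' u \<bullet> v - g' v \<bullet> u\<bar> \<le> e" if "0 < e" for e
  proof -
    have N: "4 * N + 1 > 0" "N \<ge> 0"
      by (simp_all add: N_def add_nonneg_pos)
    then have "4 * (e / (4 * N + 1)) * N \<le> e"
      using that by (simp add: field_simps)
    then show ?thesis
      using bound[of "e / (4 * N + 1)"] that N by simp
  qed
  then have "\<bar>g' u \<bullet> v - g' v \<bullet> u\<bar> \<le> 0"
    by - (rule field_le_epsilon, simp)
  then show ?thesis by simp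
qed

lemma gderiv_unique:
  assumes "GDERIV f x :> D" "GDERIV f x :> E"
  shows "D = E"
proof -
  have "(\<lambda>h. h \<bullet> D) = (\<lambda>h. h \<bullet> E)"
    using assms has_derivative_unique unfolding gderiv_def by blast
  then show ?thesis
    by (metis inner_commute vector_eq_rdot)
qed

lemma grad_eqI: "GDERIV f x :> D \<Longrightarrow> grad f x = D"
  unfolding grad_def by (blast intro: gderiv_unique)

text \<open>\<open>grad\<close> is a definite description, so a witness is needed: the Riesz
  representative \<open>adjoint f' 1\<close> of the derivative.\<close>

lemma gderiv_grad:
  fixes f :: "'a::euclidean_space \<Rightarrow> real"
  assumes "f differentiable (at x)"
  shows "GDERIV f x :> grad f x"
proof -
  obtain f' where f': "(f has_derivative f') (at x)"
    using assms by (auto simp: differentiable_def)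
  then have "linear f'"
    by (rule has_derivative_linear)
  then have "f' = (\<lambda>h. h \<bullet> adjoint f' 1)"
    by (simp add: adjoint_works)
  then have "GDERIV f x :> adjoint f' 1"
    using f' by (simp add: gderiv_def)
  with grad_eqI[OF this] show ?thesis
    by simp
qed

lemma has_derivative_grad:
  assumes "twice_differentiable f"
  shows "(grad f has_derivative (\<lambda>h. hessian f x *v h)) (at x)"
  using assms unfolding twice_differentiable_def hessian_def jacobian_works[symmetric] by blast

lemma hessian_symmetric:
  assumes "twice_differentiable f"
  shows "(hessian f x *v u) \<bullet> v = (hessian f x *v v) \<bullet> u"
  by (rule derivative_of_gradient_symmetric[OF gderiv_grad has_derivative_grad[OF assms]])
    (use assms in \<open>simp add: twice_differentiable_def\<close>)

section \<open>Matrices and stacked vectors\<close>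

lemma inner_matrix_vector_mult:
  fixes A :: "real^'n^'m"
  shows "x \<bullet> (A *v y) = (transpose A *v x) \<bullet> y"
  by (metis dot_lmul_matrix vector_transpose_matrix transpose_transpose)

lemma invertible_matrix_inv:
  assumes "invertible A"
  shows "A ** matrix_inv A = mat 1" "matrix_inv A ** A = mat 1"
  using someI_ex[OF assms[unfolded invertible_def]] by (simp_all add: matrix_inv_def)

text \<open>An inverse satisfies the Penrose equations at once. Conversely, multiplying
  \<open>A ** Y ** A = A\<close> by \<open>X\<close> on both sides isolates
  \<open>Y\<close>.\<close>

lemma pinv_inverse:
  fixes A X :: "real^'n^'n"
  assumes "A ** X = mat 1" "X ** A = mat 1"
  shows "pinv A = X"
  unfolding pinv_def
proof (rule the_equality)
  fix Y assume Y: "A ** Y ** A = A \<and> Y ** A ** Y = Y \<and>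
    transpose (A ** Y) = A ** Y \<and> transpose (Y ** A) = Y ** A"
  have "Y = (X ** A) ** Y ** (A ** X)"
    by (simp add: assms)
  also have "\<dots> = X ** (A ** Y ** A) ** X"
    by (simp only: matrix_mul_assoc)
  also have "\<dots> = X"
    using Y assms by simp
  finally show "Y = X" .
qed (simp_all add: assms)

lemma inner_stack: "stack w a \<bullet> stack w' a' = w \<bullet> w' + (\<Sum>i\<in>UNIV. a i \<bullet> a' i)"
  for w w' :: "real^'d" and a a' :: "'n::finite \<Rightarrow> real^'d"
proof -
  have "stack w a \<bullet> stack w' a' = (\<Sum>p\<in>UNIV \<times> UNIV. stack w a $ p * stack w' a' $ p)"
    unfolding inner_vec_def UNIV_Times_UNIV by simp
  also have "\<dots> = (\<Sum>b\<in>UNIV. \<Sum>c\<in>UNIV. stack w a $ (b, c) * stack w' a' $ (b, c))"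
    by (simp add: sum.cartesian_product case_prod_beta)
  also have "\<dots> = w \<bullet> w' + (\<Sum>i\<in>UNIV. a i \<bullet> a' i)"
    unfolding inner_vec_def by (simp add: UNIV_option_conv sum.reindex stack_def)
  finally show ?thesis .
qed

lemma inner_state: "x \<bullet> y = w_part x \<bullet> w_part y + (\<Sum>i\<in>UNIV. a_part x i \<bullet> a_part y i)"
  for x y :: "('d::finite, 'n::finite) state"
  by (metis inner_stack stack_parts)

lemma state_eqI: "w_part x = w_part y \<Longrightarrow> (\<And>i. a_part x i = a_part y i) \<Longrightarrow> x = y"
proof -
  assume "w_part x = w_part y" "\<And>i. a_part x i = a_part y i"
  then have "stack (w_part x) (a_part x) = stack (w_part y) (a_part y)"
    by presburger
  then show ?thesis by simp
qed

lemma bounded_linear_parts: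
  "bounded_linear (w_part :: ('d::finite, 'n::finite) state \<Rightarrow> _)"
  "bounded_linear (\<lambda>x :: ('d, 'n) state. a_part x i)"
  by (auto simp: w_part_def a_part_def vec_eq_iff linear_iff
      intro!: linear_conv_bounded_linear[THEN iffD1])

lemma parts_linear [simp]:
  "w_part (x + y) = w_part x + w_part y" "a_part (x + y) i = a_part x i + a_part y i"
  "w_part (x - y) = w_part x - w_part y" "a_part (x - y) i = a_part x i - a_part y i"
  "w_part (- x) = - w_part x" "a_part (- x) i = - a_part x i"
  "w_part 0 = 0" "a_part 0 i = 0"
  by (simp_all add: w_part_def a_part_def vec_eq_iff)

lemma sum_option: "(\<Sum>b\<in>UNIV. f b) = f None + (\<Sum>i\<in>UNIV. f (Some i))"
  for f :: "'n::finite option \<Rightarrow> 'a::comm_monoid_add"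
  by (simp add: UNIV_option_conv sum.reindex)

lemma block_matrix_mult_component:
  fixes A :: "'r::finite \<Rightarrow> 's::finite option \<Rightarrow> real^'d^'e" and v :: "('d, 's) state"
  shows "(block_matrix A *v v) $ (r, c) =
    (A r None *v w_part v + (\<Sum>j\<in>UNIV. A r (Some j) *v a_part v j)) $ c"
proof -
  have "(block_matrix A *v v) $ (r, c) = (\<Sum>q\<in>UNIV \<times> UNIV. A r (fst q) $ c $ snd q * v $ q)"
    by (simp add: matrix_vector_mult_def block_matrix_def)
  also have "\<dots> = (\<Sum>s\<in>UNIV. \<Sum>k\<in>UNIV. A r s $ c $ k * v $ (s, k))"
    by (simp only: sum.cartesian_product) (simp add: case_prod_beta)
  also have "\<dots> = (A r None *v w_part v + (\<Sum>j\<in>UNIV. A r (Some j) *v a_part v j)) $ c"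
    by (simp add: sum_option matrix_vector_mult_def w_part_def a_part_def)
  finally show ?thesis .
qed

lemma block_matrix_mult_parts:
  fixes A :: "'r::finite option \<Rightarrow> 's::finite option \<Rightarrow> real^'d^'e" and v :: "('d, 's) state"
  shows "w_part (block_matrix A *v v) = A None None *v w_part v + (\<Sum>j\<in>UNIV. A None (Some j) *v a_part v j)"
    and "a_part (block_matrix A *v v) i = A (Some i) None *v w_part v + (\<Sum>j\<in>UNIV. A (Some i) (Some j) *v a_part v j)"
  by (simp_all add: vec_eq_iff w_part_def[of "block_matrix A *v v"] a_part_def[of "block_matrix A *v v"]
      block_matrix_mult_component)

text \<open>Injectivity of \<open>D ** S\<close> makes the Gram matrix \<open>A\<close> invertible,
  so the pseudoinverse is an ordinary inverse. Then \<open>D *v (H *v r)\<close> is the only vector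
  in the range of \<open>D ** S\<close> whose inner product with every \<open>D *v (S *v u)\<close>
  is \<open>(S *v u) \<bullet> r\<close>; the third claim is a test for it that avoids computing an
  inverse.\<close>

lemma sketched_normal_equations:
  fixes D :: "real^'m^'k" and S :: "real^'s^'m"
  defines "A \<equiv> transpose S ** transpose D ** D ** S"
  defines "H \<equiv> S ** pinv A ** transpose S"
  assumes inj: "\<And>v. D *v (S *v v) = 0 \<Longrightarrow> v = 0"
  shows "transpose H = H"
    and "(norm (D *v (H *v r)))\<^sup>2 = r \<bullet> (H *v r)"
    and "d = D *v (S *v v) \<Longrightarrow> (\<And>u. (D *v (S *v u)) \<bullet> d = (S *v u) \<bullet> r) \<Longrightarrow> D *v (H *v r) = d"
proof -
  have A_mult: "A *v v = transpose S *v (transpose D *v (D *v (S *v v)))" for v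
    by (simp add: A_def matrix_vector_mul_assoc matrix_mul_assoc)
  have A_inner: "u \<bullet> (A *v v) = (D *v (S *v u)) \<bullet> (D *v (S *v v))" for u v
    by (simp only: A_mult inner_matrix_vector_mult transpose_transpose)
  have A_inj: "v = 0" if "A *v v = 0" for v
    using A_inner[of v v] that inj by simp
  have "inj ((*v) A)"
    using A_inj by (simp add: linear_injective_0)
  then have "invertible A"
    by (simp add: invertible_left_inverse matrix_left_invertible_injective)
  then obtain X where X: "A ** X = mat 1" "X ** A = mat 1"
    unfolding invertible_def by blast
  have "transpose A = A"
    by (simp add: A_def matrix_transpose_mul matrix_mul_assoc)
  then have "A ** transpose X = mat 1"
    by (metis X(2) matrix_transpose_mul transpose_mat)
  then have "transpose X = X"
    by (metis X(2) matrix_mul_assoc matrix_mul_lid matrix_mul_rid)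
  have H: "H = S ** X ** transpose S"
    using pinv_inverse[OF X] by (simp add: H_def)
  then show "transpose H = H"
    by (simp add: \<open>transpose X = X\<close> matrix_transpose_mul matrix_mul_assoc)
  \<comment> \<open>Coordinates of \<open>H *v r\<close> in the sketch: \<open>q\<close> is the
    solution of the normal equations.\<close>
  define q where "q = X *v (transpose S *v r)"
  have Hr: "H *v r = S *v q"
    by (simp only: H q_def matrix_vector_mul_assoc matrix_mul_assoc)
  have Aq: "A *v q = transpose S *v r"
    by (simp add: q_def matrix_vector_mul_assoc X)
  have "(norm (D *v (H *v r)))\<^sup>2 = q \<bullet> (A *v q)"
    by (simp add: power2_norm_eq_inner Hr A_inner)
  also have "\<dots> = r \<bullet> (H *v r)"
    unfolding Aq Hr inner_matrix_vector_mult[of q] transpose_transpose by (rule inner_commute)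
  finally show "(norm (D *v (H *v r)))\<^sup>2 = r \<bullet> (H *v r)" .
  assume d: "d = D *v (S *v v)" "\<And>u. (D *v (S *v u)) \<bullet> d = (S *v u) \<bullet> r"
  \<comment> \<open>Tested against every \<open>u\<close>, the assumptions say that \<open>v\<close>
    solves the same normal equations as \<open>q\<close>, and injectivity of \<open>A\<close>
    identifies the two.\<close>
  have "u \<bullet> (A *v v) = u \<bullet> (A *v q)" for u
  proof -
    have "u \<bullet> (A *v v) = (S *v u) \<bullet> r"
      by (simp only: A_inner d(1)[symmetric] d(2))
    also have "\<dots> = u \<bullet> (A *v q)"
      by (simp only: Aq inner_matrix_vector_mult transpose_transpose)
    finally show ?thesis .
  qed
  then have "A *v v = A *v q"
    by (metis inner_commute vector_eq_rdot)
  then have "v = q"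
    using A_inj[of "v - q"] by (simp add: matrix_vector_mult_diff_distrib)
  then show "D *v (H *v r) = d"
    by (simp add: Hr d(1))
qed

section \<open>The sketched Newton step\<close>

lemma has_derivative_stack:
  fixes g :: "'n::finite \<Rightarrow> 'a::real_normed_vector \<Rightarrow> real^'d"
  assumes "(f has_derivative f') (at x within S)" "\<And>i. (g i has_derivative g' i) (at x within S)"
  shows "((\<lambda>x. stack (f x) (\<lambda>i. g i x)) has_derivative (\<lambda>h. stack (f' h) (\<lambda>i. g' i h))) (at x within S)"
proof -
  have "((\<lambda>x. case p of (None, c) \<Rightarrow> f x $ c | (Some i, c) \<Rightarrow> g i x $ c) has_derivative
      (\<lambda>h. case p of (None, c) \<Rightarrow> f' h $ c | (Some i, c) \<Rightarrow> g' i h $ c)) (at x within S)" for p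
    using bounded_linear.has_derivative[OF bounded_linear_vec_nth assms(1)]
      bounded_linear.has_derivative[OF bounded_linear_vec_nth assms(2)]
    by (cases p; cases "fst p") auto
  then show ?thesis
    by (subst has_derivative_componentwise_within) (auto simp: Basis_vec_def inner_axis stack_def)
qed

lemma sum_matrix_vector_mult: "(\<Sum>i\<in>I. A i) *v x = (\<Sum>i\<in>I. A i *v x)"
  for A :: "'i \<Rightarrow> 'a::semiring_1^'n^'m"
  by (induction I rule: infinite_finite_induct) (simp_all add: matrix_vector_mult_add_rdistrib)

lemmas has_derivative_parts [derivative_intros] =
  bounded_linear_imp_has_derivative[OF bounded_linear_parts(1)]
  bounded_linear_imp_has_derivative[OF bounded_linear_parts(2)]

lemma snm_F_has_derivative:
  fixes \<phi> :: "'n::finite \<Rightarrow> real^'d \<Rightarrow> real"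
  assumes "\<And>i. twice_differentiable (\<phi> i)"
  shows "(snm_F \<phi> has_derivative
    (\<lambda>h. stack ((1 / real CARD('n)) *\<^sub>R (\<Sum>i\<in>UNIV. hessian (\<phi> i) (a_part z i) *v a_part h i))
      (\<lambda>i. w_part h - a_part h i))) (at z)"
proof -
  have "((\<lambda>x. grad (\<phi> i) (a_part x i)) has_derivative (\<lambda>h. hessian (\<phi> i) (a_part z i) *v a_part h i)) (at z)" for i
    using has_derivative_compose[OF has_derivative_parts(2) has_derivative_grad[OF assms]] .
  then show ?thesis
    unfolding snm_F_def
    by (intro has_derivative_stack derivative_intros)
qed

text \<open>As \<open>snm_DF\<close> is the transposed Jacobian, this pairing determines it from any
  known derivative of \<open>snm_F\<close>, without expanding matrix entries.\<close>

lemma snm_DF_inner: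
  fixes \<phi> :: "'n::finite \<Rightarrow> real^'d \<Rightarrow> real"
  assumes "(snm_F \<phi> has_derivative F') (at z)"
  shows "(snm_DF \<phi> z *v u) \<bullet> h = u \<bullet> F' h"
proof -
  have "snm_F \<phi> differentiable (at z)"
    using assms by (auto simp: differentiable_def)
  then have "(snm_F \<phi> has_derivative (\<lambda>h. jacobian (snm_F \<phi>) (at z) *v h)) (at z)"
    by (simp only: jacobian_works)
  then have "F' = (\<lambda>h. jacobian (snm_F \<phi>) (at z) *v h)"
    by (rule has_derivative_unique[OF assms])
  then show ?thesis
    by (simp only: snm_DF_def inner_matrix_vector_mult)
qed

text \<open>Pair with an arbitrary \<open>h\<close> and move every factor off \<open>h\<close>;
  symmetry lets each Hessian act on \<open>w_part u\<close> instead.\<close>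

lemma snm_DF_mult:
  fixes \<phi> :: "'n::finite \<Rightarrow> real^'d \<Rightarrow> real"
  assumes \<phi>: "\<And>i. twice_differentiable (\<phi> i)"
  shows "snm_DF \<phi> z *v u = stack (\<Sum>i\<in>UNIV. a_part u i)
    (\<lambda>i. (1 / real CARD('n)) *\<^sub>R (hessian (\<phi> i) (a_part z i) *v w_part u) - a_part u i)"
proof -
  have sym: "w_part u \<bullet> (hessian (\<phi> i) y *v h) = (hessian (\<phi> i) y *v w_part u) \<bullet> h" for i y h
    using hessian_symmetric[OF \<phi>] by (metis inner_commute)
  have "(snm_DF \<phi> z *v u) \<bullet> h = stack (\<Sum>i\<in>UNIV. a_part u i)
    (\<lambda>i. (1 / real CARD('n)) *\<^sub>R (hessian (\<phi> i) (a_part z i) *v w_part u) - a_part u i) \<bullet> h" for h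
    unfolding snm_DF_inner[OF snm_F_has_derivative[OF \<phi>]]
    by (simp only: inner_state[of u] inner_stack w_part_stack a_part_stack inner_state[of _ h] sym
        inner_scaleR_left inner_scaleR_right inner_sum_left inner_sum_right inner_diff_left
        inner_diff_right sum_subtractf sum_distrib_left)
  then show ?thesis
    by (rule vector_eq_rdot[THEN iffD1, OF allI])
qed

lemma sketch_mult:
  fixes \<phi> :: "'n::{finite,linorder} \<Rightarrow> real^'d \<Rightarrow> real"
    and v :: "('d, 't::{finite,linorder}) state"
  shows "w_part (sketch \<phi> z B *v v) = w_part v"
    and "a_part (sketch \<phi> z B *v v) i = (1 / real CARD('n)) *\<^sub>R (hessian (\<phi> i) (a_part z i) *v w_part v)
      + (\<Sum>j\<in>UNIV. if i = enum_set B j then a_part v j else 0)"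
proof -
  have *: "(if b then mat 1 else 0) *v x = (if b then x else 0)" for b and x :: "real^'d"
    by simp
  show "w_part (sketch \<phi> z B *v v) = w_part v"
    "a_part (sketch \<phi> z B *v v) i = (1 / real CARD('n)) *\<^sub>R (hessian (\<phi> i) (a_part z i) *v w_part v)
      + (\<Sum>j\<in>UNIV. if i = enum_set B j then a_part v j else 0)"
    unfolding sketch_def block_matrix_mult_parts
    by (simp_all add: * scaleR_matrix_vector_assoc)
qed

lemma sum_enum_blocks:
  fixes e :: "'t::finite \<Rightarrow> 'n::finite" and v :: "'t \<Rightarrow> 'a::comm_monoid_add"
  shows "(\<Sum>i\<in>UNIV. \<Sum>j\<in>UNIV. if i = e j then v j else 0) = (\<Sum>j\<in>UNIV. v j)"
  by (subst sum.swap) simp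

lemma avg_hessian_mult:
  fixes \<phi> :: "'n::finite \<Rightarrow> real^'d \<Rightarrow> real"
  shows "avg_hessian \<phi> z *v x = (\<Sum>i\<in>UNIV. (1 / real CARD('n)) *\<^sub>R (hessian (\<phi> i) (a_part z i) *v x))"
  unfolding avg_hessian_def
  by (simp only: scaleR_matrix_vector_assoc[symmetric] sum_matrix_vector_mult scaleR_sum_right)

text \<open>This is what the Hessian column of the sketch is for: its contribution cancels in all
  blocks but the first, where it leaves the averaged Hessian. The sampled identity blocks contribute
  their sum to the first block and reappear negated in their own places.\<close>

lemma snm_DF_sketch_mult:
  fixes \<phi> :: "'n::{finite,linorder} \<Rightarrow> real^'d \<Rightarrow> real"
    and v :: "('d, 't::{finite,linorder}) state"
  assumes \<phi>: "\<And>i. twice_differentiable (\<phi> i)"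
  shows "snm_DF \<phi> z *v (sketch \<phi> z B *v v) =
    stack (avg_hessian \<phi> z *v w_part v + (\<Sum>j\<in>UNIV. a_part v j))
      (\<lambda>i. - (\<Sum>j\<in>UNIV. if i = enum_set B j then a_part v j else 0))"
  unfolding snm_DF_mult[OF \<phi>] sketch_mult sum.distrib sum_enum_blocks avg_hessian_mult by simp

lemma sum_enum_blocks_inner:
  fixes e :: "'t::finite \<Rightarrow> 'n::finite" and u :: "'t \<Rightarrow> 'a::real_inner"
  shows "(\<Sum>i\<in>UNIV. (\<Sum>j\<in>UNIV. if i = e j then u j else 0) \<bullet> d i) = (\<Sum>j\<in>UNIV. u j \<bullet> d (e j))"
proof -
  have "(\<Sum>j\<in>UNIV. if i = e j then u j else 0) \<bullet> d i
      = (\<Sum>j\<in>UNIV. if i = e j then u j \<bullet> d (e j) else 0)" for i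
    unfolding inner_sum_left by (intro sum.cong) auto
  then show ?thesis
    by (simp add: sum_enum_blocks)
qed

lemma sum_enum_blocks_inj:
  fixes e :: "'t::finite \<Rightarrow> 'n" and v :: "'t \<Rightarrow> 'a::comm_monoid_add"
  assumes "inj e"
  shows "(\<Sum>j\<in>UNIV. if e k = e j then v j else 0) = v k"
  using assms by (simp add: inj_eq)

text \<open>The formula for the Newton point, multiplied by the averaged Hessian and recentred at
  \<open>w_part z\<close>, becomes the first block row of the sketched system: the blocks of
  \<open>snm_F \<phi> z\<close> appear on the right.\<close>

lemma newton_point_equation:
  fixes \<phi> :: "'n::finite \<Rightarrow> real^'d \<Rightarrow> real"
  assumes "invertible (avg_hessian \<phi> z)"
  shows "avg_hessian \<phi> z *v (w_part z - newton_point \<phi> z) =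
    w_part (snm_F \<phi> z)
    + (\<Sum>i\<in>UNIV. (1 / real CARD('n)) *\<^sub>R (hessian (\<phi> i) (a_part z i) *v (w_part z - a_part z i)))"
proof -
  have "avg_hessian \<phi> z *v newton_point \<phi> z =
      (1 / real CARD('n)) *\<^sub>R (\<Sum>i\<in>UNIV. hessian (\<phi> i) (a_part z i) *v a_part z i) - w_part (snm_F \<phi> z)"
    using invertible_matrix_inv(1)[OF assms]
    by (simp add: newton_point_def snm_F_def matrix_vector_mul_assoc)
  then show ?thesis
    by (simp add: matrix_vector_mult_diff_distrib avg_hessian_mult scaleR_diff_right sum_subtractf
        scaleR_sum_right)
qed

text \<open>The displacement passes the test of \<open>sketched_normal_equations\<close>: it lies in
  the range of \<open>snm_DF \<phi> z ** S\<close> and solves the sketched Newton system. Its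
  squared length then comes from the second claim there.\<close>

lemma
  fixes \<phi> :: "'n::{finite,linorder} \<Rightarrow> real^'d \<Rightarrow> real" and z :: "('d, 'n) state" and B :: "'n set"
  defines "S \<equiv> sketch \<phi> z B :: real^('t::{finite,linorder} option \<times> 'd)^('n option \<times> 'd)"
  assumes \<phi>: "\<And>i. twice_differentiable (\<phi> i)"
    and inv: "invertible (avg_hessian \<phi> z)" and B: "card B = CARD('t)"
  shows transpose_snm_H: "transpose (snm_H \<phi> S z) = snm_H \<phi> S z"
    and snm_step_sketched: "snm_DF \<phi> z *v (snm_H \<phi> S z *v snm_F \<phi> z) = z - snm_step \<phi> B z"
    and norm_snm_step: "(norm (z - snm_step \<phi> B z))\<^sup>2 = snm_F \<phi> z \<bullet> (snm_H \<phi> S z *v snm_F \<phi> z)"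
proof -
  define e :: "'t \<Rightarrow> 'n" where "e = enum_set B"
  define D where "D = snm_DF \<phi> z"
  define A where "A = avg_hessian \<phi> z"
  have "inj e" and range_e: "range e = B"
    using enum_set[OF B] by (auto simp: e_def intro: strict_mono_imp_inj_on)
  have DS: "D *v (S *v v) = stack (A *v w_part v + (\<Sum>j\<in>UNIV. a_part v j))
      (\<lambda>i. - (\<Sum>j\<in>UNIV. if i = e j then a_part v j else 0))" for v
    unfolding D_def S_def A_def e_def by (rule snm_DF_sketch_mult[OF \<phi>])
  \<comment> \<open>The sampled blocks of the image are the negated \<open>a_part v j\<close>, so
    these vanish first; what remains is the averaged Hessian applied to
    \<open>w_part v\<close>.\<close>
  have inj: "v = 0" if v: "D *v (S *v v) = 0" for v
  proof (rule state_eqI)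
    have "a_part (D *v (S *v v)) (e j) = 0" for j
      by (simp add: v)
    then have a: "a_part v j = 0" for j
      by (simp add: DS sum_enum_blocks_inj[OF \<open>inj e\<close>])
    then show "a_part v j = a_part 0 j" for j
      by simp
    have "w_part (D *v (S *v v)) = 0"
      by (simp add: v)
    then have "A *v w_part v = 0"
      by (simp add: DS a)
    then have "matrix_inv A *v (A *v w_part v) = 0"
      by simp
    then show "w_part v = w_part 0"
      using invertible_matrix_inv(2)[OF inv] by (simp add: A_def matrix_vector_mul_assoc)
  qed
  have H: "snm_H \<phi> S z = S ** pinv (transpose S ** transpose D ** D ** S) ** transpose S"
    by (simp add: snm_H_def D_def)
  show "transpose (snm_H \<phi> S z) = snm_H \<phi> S z"
    unfolding H by (rule sketched_normal_equations(1)[OF inj])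
  define d where "d = z - snm_step \<phi> B z"
  define p where "p = newton_point \<phi> z"
  have d_parts: "w_part d = w_part z - p" "a_part d i = (if i \<in> B then a_part z i - p else 0)" for i
    by (simp_all add: d_def snm_step_def p_def)
  \<comment> \<open>The sampled blocks are dictated by the sign change in \<open>DS\<close>. They
    also add their sum to the first block, and the first block of \<open>v\<close> is chosen to
    compensate for it.\<close>
  define v where "v = stack (matrix_inv A *v (w_part z - p + (\<Sum>j\<in>UNIV. a_part z (e j) - p)))
    (\<lambda>j. - (a_part z (e j) - p))"
  have d_range: "d = D *v (S *v v)"
  proof (rule state_eqI)
    have "A *v (matrix_inv A *v y) = y" for y
      using invertible_matrix_inv(1)[OF inv] by (simp add: A_def matrix_vector_mul_assoc)
    then show "w_part d = w_part (D *v (S *v v))"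
      by (simp add: DS v_def d_parts sum_negf sum_subtractf)
    show "a_part d i = a_part (D *v (S *v v)) i" for i
    proof (cases "i \<in> B")
      case True
      then obtain k where "i = e k"
        using range_e by auto
      then show ?thesis
        using True by (simp add: DS v_def d_parts sum_enum_blocks_inj[OF \<open>inj e\<close>])
    next
      case False
      then have "i \<noteq> e j" for j
        using range_e by auto
      then show ?thesis
        using False by (simp add: DS d_parts)
    qed
  qed
  have d_eq: "(D *v (S *v u)) \<bullet> d = (S *v u) \<bullet> snm_F \<phi> z" for u
  proof -
    have A_sym: "(A *v x) \<bullet> y = x \<bullet> (A *v y)" for x y
      unfolding A_def avg_hessian_mult inner_sum_left inner_sum_right
      using hessian_symmetric[OF \<phi>] by (simp add: inner_commute)
    have de: "a_part d (e j) = a_part z (e j) - p" for j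
      using range_e by (auto simp: d_parts)
    have "(D *v (S *v u)) \<bullet> d = w_part u \<bullet> (A *v (w_part z - p))
        + ((\<Sum>j\<in>UNIV. a_part u j \<bullet> (w_part z - p)) - (\<Sum>j\<in>UNIV. a_part u j \<bullet> (a_part z (e j) - p)))"
      unfolding DS inner_state[of _ d] w_part_stack a_part_stack d_parts(1) inner_add_left A_sym
        inner_minus_left sum_negf sum_enum_blocks_inner de by (simp add: inner_sum_left)
    \<comment> \<open>The Newton point cancels in each sampled block, leaving the block
      \<open>w_part z - a_part z (e j)\<close> of \<open>snm_F \<phi> z\<close>.\<close>
    also have "\<dots> = w_part u \<bullet> (A *v (w_part z - p))
        + (\<Sum>j\<in>UNIV. a_part u j \<bullet> (w_part z - a_part z (e j)))"
      unfolding sum_subtractf[symmetric] by (simp add: inner_diff_right)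
    \<comment> \<open>The Newton equation turns the other term into the pairing of the first block
      column of the sketch with \<open>snm_F \<phi> z\<close>.\<close>
    also have "w_part u \<bullet> (A *v (w_part z - p)) = w_part u \<bullet> w_part (snm_F \<phi> z)
       + (\<Sum>i\<in>UNIV. ((1 / real CARD('n)) *\<^sub>R (hessian (\<phi> i) (a_part z i) *v w_part u))
           \<bullet> (w_part z - a_part z i))"
      unfolding A_def p_def newton_point_equation[OF inv] inner_add_right inner_sum_right
        inner_scaleR_left inner_scaleR_right hessian_symmetric[OF \<phi>, of _ _ "w_part u"]
      by (simp only: inner_commute)
    also have "\<dots> + (\<Sum>j\<in>UNIV. a_part u j \<bullet> (w_part z - a_part z (e j))) = (S *v u) \<bullet> snm_F \<phi> z"
      unfolding S_def inner_state[of _ "snm_F \<phi> z"] sketch_mult e_def[symmetric] inner_add_left sum.distrib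
        sum_enum_blocks_inner by (simp add: snm_F_def)
    finally show ?thesis .
  qed
  show "snm_DF \<phi> z *v (snm_H \<phi> S z *v snm_F \<phi> z) = z - snm_step \<phi> B z"
    using sketched_normal_equations(3)[OF inj d_range d_eq] by (simp only: H D_def d_def)
  then show "(norm (z - snm_step \<phi> B z))\<^sup>2 = snm_F \<phi> z \<bullet> (snm_H \<phi> S z *v snm_F \<phi> z)"
    using sketched_normal_equations(2)[of D S "snm_F \<phi> z", OF inj] by (simp only: H D_def)
qed

section \<open>Averaging over the sampled subset\<close>

lemma card_subsets_pos:
  assumes "\<tau> \<le> CARD('n::finite)"
  shows "card {B :: 'n set. card B = \<tau>} > 0"
proof -
  obtain B :: "'n set" where "card B = \<tau>"
    using obtain_subset_with_card_n[OF assms] by blast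
  then show ?thesis
    by (auto simp: card_gt_0_iff)
qed

lemma pmf_uniform_subset:
  fixes B :: "'n::finite set"
  assumes "\<tau> \<le> CARD('n)"
  shows "pmf (uniform_subset \<tau>) B =
    (if card B = \<tau> then 1 / real (card {B :: 'n set. card B = \<tau>}) else 0)"
proof -
  have "{B :: 'n set. card B = \<tau>} \<noteq> {}"
    using card_subsets_pos[OF assms] by force
  then show ?thesis
    by (simp add: uniform_subset_def pmf_of_set)
qed

lemma snm_EH_eq:
  fixes \<phi> :: "'n::{finite,linorder} \<Rightarrow> real^'d \<Rightarrow> real"
  shows "snm_EH TYPE('t::{finite,linorder}) \<phi> z =
    (\<Sum>B\<in>UNIV. pmf (uniform_subset CARD('t)) B *\<^sub>R
       snm_H \<phi> (sketch \<phi> z B :: real^('t option \<times> 'd)^('n option \<times> 'd)) z)"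
  unfolding snm_EH_def sketch_distr_def integral_map_pmf
  by (rule integral_measure_pmf) auto

text \<open>Symmetry of the averaged matrix makes the two terms of the product rule equal, which
  absorbs the factor 1/2; \<open>z\<close> is frozen, so only \<open>snm_F\<close> is
  differentiated.\<close>

lemma gderiv_snm_f:
  fixes \<phi> :: "'n::{finite,linorder} \<Rightarrow> real^'d \<Rightarrow> real"
  assumes F: "(snm_F \<phi> has_derivative F') (at y)"
    and sym: "transpose (snm_EH T \<phi> z) = snm_EH T \<phi> z"
  shows "GDERIV (snm_f T \<phi> z) y :> snm_DF \<phi> y *v (snm_EH T \<phi> z *v snm_F \<phi> y)"
proof -
  define E where "E = snm_EH T \<phi> z"
  have E: "((\<lambda>x. E *v snm_F \<phi> x) has_derivative (\<lambda>h. E *v F' h)) (at y)"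
    by (rule bounded_linear.has_derivative[OF matrix_vector_mul_bounded_linear F])
  have "snm_F \<phi> y \<bullet> (E *v F' h) = F' h \<bullet> (E *v snm_F \<phi> y)" for h
    using sym inner_matrix_vector_mult by (metis E_def inner_commute)
  then have "(snm_f T \<phi> z has_derivative (\<lambda>h. F' h \<bullet> (E *v snm_F \<phi> y))) (at y)"
    unfolding snm_f_def E_def[symmetric]
    by (auto intro!: derivative_eq_intros F E)
  moreover have "(\<lambda>h. F' h \<bullet> (E *v snm_F \<phi> y)) = (\<lambda>h. h \<bullet> (snm_DF \<phi> y *v (E *v snm_F \<phi> y)))"
    by (metis snm_DF_inner[OF F] inner_commute)
  ultimately show ?thesis
    by (simp add: gderiv_def E_def)
qed

lemma grad_avg_fun:
  fixes \<phi> :: "'n::finite \<Rightarrow> real^'d \<Rightarrow> real"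
  assumes "\<And>i. twice_differentiable (\<phi> i)"
  shows "grad (avg_fun \<phi>) w = (1 / real CARD('n)) *\<^sub>R (\<Sum>i\<in>UNIV. grad (\<phi> i) w)"
proof (rule grad_eqI)
  have "(\<phi> i has_derivative (\<lambda>h. h \<bullet> grad (\<phi> i) w)) (at w)" for i
    using gderiv_grad[of "\<phi> i" w] assms by (simp add: twice_differentiable_def gderiv_def)
  then have "((\<lambda>w. (1 / real CARD('n)) * (\<Sum>i\<in>UNIV. \<phi> i w)) has_derivative
      (\<lambda>h. (1 / real CARD('n)) * (\<Sum>i\<in>UNIV. h \<bullet> grad (\<phi> i) w))) (at w)"
    by (intro has_derivative_mult_right has_derivative_sum)
  then show "GDERIV (avg_fun \<phi>) w :> (1 / real CARD('n)) *\<^sub>R (\<Sum>i\<in>UNIV. grad (\<phi> i) w)"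
    by (simp add: gderiv_def avg_fun_def[abs_def] inner_sum_right)
qed

text \<open>Deterministic in \<open>z\<close>, so that it can be applied conditionally on the
  current iterate.\<close>

lemma snm_step_contraction:
  fixes \<phi> :: "'n::{finite,linorder} \<Rightarrow> real^'d \<Rightarrow> real" and z xs :: "('d, 'n) state"
  defines "f \<equiv> snm_f TYPE('t::{finite,linorder}) \<phi> z"
  assumes \<phi>: "\<And>i. twice_differentiable (\<phi> i)"
    and inv: "invertible (avg_hessian \<phi> z)" and card: "CARD('t) \<le> CARD('n)"
    and zero: "snm_F \<phi> xs = 0"
    and convex: "f xs \<ge> f z + grad f z \<bullet> (xs - z) + \<mu> / 2 * (norm (xs - z))\<^sup>2"
  shows "(\<Sum>B\<in>UNIV. pmf (uniform_subset CARD('t)) B * (norm (snm_step \<phi> B z - xs))\<^sup>2)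
    \<le> (1 - \<mu>) * (norm (z - xs))\<^sup>2"
proof -
  define q :: "'n set \<Rightarrow> real" where "q = pmf (uniform_subset CARD('t))"
  define H where "H B = snm_H \<phi> (sketch \<phi> z B :: real^('t option \<times> 'd)^('n option \<times> 'd)) z" for B
  define E where "E = snm_EH TYPE('t) \<phi> z"
  define F where "F = snm_F \<phi> z"
  \<comment> \<open>Subsets of the wrong size carry weight zero, and the sketch identities are
    available only for the right size. Hence the facts \<open>step\<close> are all stated with the
    factor \<open>q B\<close>, which lets the sums run over all subsets.\<close>
  have q0: "card B = CARD('t)" if "q B \<noteq> 0" for B
    using that by (auto simp: q_def pmf_uniform_subset[OF card] split: if_splits)
  have q1: "sum q UNIV = 1"
    unfolding q_def by (rule sum_pmf_eq_1) auto
  have E: "E = (\<Sum>B\<in>UNIV. q B *\<^sub>R H B)"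
    by (simp add: E_def q_def H_def snm_EH_eq)
  have step: "q B *\<^sub>R transpose (H B) = q B *\<^sub>R H B"
    "q B *\<^sub>R (snm_DF \<phi> z *v (H B *v F)) = q B *\<^sub>R (z - snm_step \<phi> B z)"
    "q B * (norm (z - snm_step \<phi> B z))\<^sup>2 = q B * (F \<bullet> (H B *v F))" for B
    using q0[of B] transpose_snm_H[OF \<phi> inv] snm_step_sketched[OF \<phi> inv] norm_snm_step[OF \<phi> inv]
    by (auto simp: H_def F_def)
  have "transpose E = (\<Sum>B\<in>UNIV. q B *\<^sub>R transpose (H B))"
    by (simp add: E transpose_def vec_eq_iff)
  then have "transpose E = E"
    by (simp add: step E)
  then have grad: "grad f z = snm_DF \<phi> z *v (E *v F)"
    unfolding f_def E_def F_def by (intro grad_eqI gderiv_snm_f[OF snm_F_has_derivative[OF \<phi>]])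
  have EF: "E *v F = (\<Sum>B\<in>UNIV. q B *\<^sub>R (H B *v F))"
    by (simp only: E sum_matrix_vector_mult scaleR_matrix_vector_assoc)
  have mean: "grad f z = (\<Sum>B\<in>UNIV. q B *\<^sub>R (z - snm_step \<phi> B z))"
    unfolding grad EF linear_sum[OF matrix_vector_mul_linear] by (simp add: matrix_vector_mult_scaleR step)
  have second: "2 * f z = (\<Sum>B\<in>UNIV. q B * (norm (z - snm_step \<phi> B z))\<^sup>2)"
    unfolding step f_def snm_f_def E_def[symmetric] F_def[symmetric] EF inner_sum_right by simp
  have "f xs = 0"
    by (simp add: f_def snm_f_def zero)
  have expand: "(norm (snm_step \<phi> B z - xs))\<^sup>2 =
      (norm (z - xs))\<^sup>2 - 2 * ((z - snm_step \<phi> B z) \<bullet> (z - xs)) + (norm (z - snm_step \<phi> B z))\<^sup>2" for B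
    by (simp add: power2_norm_eq_inner inner_diff_left inner_diff_right inner_commute)
  have "(\<Sum>B\<in>UNIV. q B * (norm (snm_step \<phi> B z - xs))\<^sup>2) =
      (\<Sum>B\<in>UNIV. q B * (norm (z - xs))\<^sup>2 - 2 * ((q B *\<^sub>R (z - snm_step \<phi> B z)) \<bullet> (z - xs))
        + q B * (norm (z - snm_step \<phi> B z))\<^sup>2)"
    unfolding expand by (simp only: inner_scaleR_left ring_distribs mult.left_commute)
  also have "\<dots> = (norm (z - xs))\<^sup>2 - 2 * (grad f z \<bullet> (z - xs)) + 2 * f z"
    unfolding mean second
    by (simp add: sum.distrib sum_subtractf sum_distrib_right[symmetric] sum_distrib_left[symmetric]
        inner_sum_left[symmetric] q1 del: inner_scaleR_left)
  \<comment> \<open>Since \<open>f xs = 0\<close>, twice the convexity inequality bounds the last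
    two terms together by \<open>- \<mu> * (norm (z - xs))\<^sup>2\<close>.\<close>
  also have "\<dots> \<le> (1 - \<mu>) * (norm (z - xs))\<^sup>2"
    using convex \<open>f xs = 0\<close> by (simp add: norm_minus_commute[of xs] inner_diff_right algebra_simps)
  finally show ?thesis
    by (simp only: q_def)
qed

section \<open>Independence of the samples\<close>

text \<open>Iterate \<open>k\<close> has consumed only the samples with index below
  \<open>k\<close>; sample \<open>k\<close> first enters iterate \<open>Suc k\<close>. The
  independence of iterate and current sample rests on this.\<close>

lemma snm_cong: "(\<And>j. j < k \<Longrightarrow> B j = B' j) \<Longrightarrow> snm \<phi> x0 B k = snm \<phi> x0 B' k"
  by (induction k) auto

text \<open>There are finitely many subsets, hence finitely many values after \<open>k\<close>
  steps. Expectations become finite sums, and no measurability of \<open>snm_step\<close> in the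
  state is required.\<close>

lemma finite_range_snm:
  fixes b :: "'c \<Rightarrow> nat \<Rightarrow> 'n::finite set"
  shows "finite (range (\<lambda>\<omega>. snm \<phi> x0 (b \<omega>) k))"
proof (induction k)
  case (Suc k)
  have "range (\<lambda>\<omega>. snm \<phi> x0 (b \<omega>) (Suc k))
      \<subseteq> (\<lambda>(B, y). snm_step \<phi> B y) ` (UNIV \<times> range (\<lambda>\<omega>. snm \<phi> x0 (b \<omega>) k))"
    by auto
  then show ?case
    by (rule finite_subset) (simp add: Suc)
qed simp

context prob_space
begin

text \<open>The iterate is a function of the samples indexed by \<open>{..<k}\<close> and the
  current sample is indexed by \<open>{k}\<close>; families over disjoint index sets are
  independent.\<close>

lemma
  fixes B :: "nat \<Rightarrow> 'a \<Rightarrow> 'n::finite set"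
  assumes indep: "indep_vars (\<lambda>_. count_space UNIV) B UNIV"
  shows events_snm: "(\<lambda>\<omega>. snm \<phi> x0 (\<lambda>j. B j \<omega>) k) -` {a} \<inter> space M \<in> events"
    and prob_snm_indep: "prob (((\<lambda>\<omega>. snm \<phi> x0 (\<lambda>j. B j \<omega>) k) -` {a} \<inter> space M) \<inter> (B k -` {b} \<inter> space M)) =
      prob ((\<lambda>\<omega>. snm \<phi> x0 (\<lambda>j. B j \<omega>) k) -` {a} \<inter> space M) * prob (B k -` {b} \<inter> space M)"
proof -
  define past where "past \<omega> = restrict (\<lambda>j. B j \<omega>) {..<k}" for \<omega>
  define now where "now \<omega> = restrict (\<lambda>j. B j \<omega>) {k}" for \<omega>
  define P where "P I = PiM I (\<lambda>_. count_space (UNIV :: 'n set set))" for I :: "nat set"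
  define U where "U = {f \<in> space (P {..<k}). snm \<phi> x0 f k = a}"
  define V where "V = {f \<in> space (P {k}). f k = b}"
  \<comment> \<open>Over finitely many coordinates the product of discrete spaces is discrete, so
    \<open>U\<close> and \<open>V\<close> are measurable whatever \<open>snm\<close> does.\<close>
  have P: "P I = count_space (PiE I (\<lambda>_. UNIV))" if "finite I" for I
    unfolding P_def using that by (rule count_space_PiM_finite) simp
  have UV: "U \<in> sets (P {..<k})" "V \<in> sets (P {k})"
    by (auto simp: P U_def V_def)
  have iv: "indep_var (P {..<k}) past (P {k}) now"
    unfolding past_def now_def P_def by (rule indep_var_restrict[OF indep]) auto
  \<comment> \<open>\<open>restrict\<close> returns \<open>undefined\<close> from index
    \<open>k\<close> on, which the iterate never reads.\<close>
  have "snm \<phi> x0 (past \<omega>) k = snm \<phi> x0 (\<lambda>j. B j \<omega>) k" for \<omega>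
    by (rule snm_cong) (simp add: past_def)
  then have U: "past -` U \<inter> space M = (\<lambda>\<omega>. snm \<phi> x0 (\<lambda>j. B j \<omega>) k) -` {a} \<inter> space M"
    by (auto simp: U_def P past_def)
  have V: "now -` V \<inter> space M = B k -` {b} \<inter> space M"
    by (auto simp: V_def P now_def)
  show "(\<lambda>\<omega>. snm \<phi> x0 (\<lambda>j. B j \<omega>) k) -` {a} \<inter> space M \<in> events"
    using measurable_sets[OF indep_var_rv1[OF iv] UV(1)] by (simp only: U)
  have "(\<lambda>\<omega>. (past \<omega>, now \<omega>)) -` (U \<times> V) \<inter> space M
      = (past -` U \<inter> space M) \<inter> (now -` V \<inter> space M)"
    by auto
  then show "prob (((\<lambda>\<omega>. snm \<phi> x0 (\<lambda>j. B j \<omega>) k) -` {a} \<inter> space M) \<inter> (B k -` {b} \<inter> space M)) =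
      prob ((\<lambda>\<omega>. snm \<phi> x0 (\<lambda>j. B j \<omega>) k) -` {a} \<inter> space M) * prob (B k -` {b} \<inter> space M)"
    using indep_varD[OF iv UV] by (simp only: U V)
qed

lemma expectation_finite_range:
  fixes g :: "'b \<Rightarrow> real"
  assumes sets: "\<And>a. a \<in> R \<Longrightarrow> X -` {a} \<inter> space M \<in> events"
    and "finite R" "X ` space M \<subseteq> R"
  shows "expectation (\<lambda>\<omega>. g (X \<omega>)) = (\<Sum>a\<in>R. prob (X -` {a} \<inter> space M) * g a)"
proof -
  have "expectation (\<lambda>\<omega>. g (X \<omega>)) = expectation (\<lambda>\<omega>. \<Sum>a\<in>R. g a * indicator (X -` {a} \<inter> space M) \<omega>)"
  proof (rule Bochner_Integration.integral_cong)
    fix \<omega> assume \<omega>: "\<omega> \<in> space M"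
    then have "(\<Sum>a\<in>R. g a * indicator (X -` {a} \<inter> space M) \<omega>) = (\<Sum>a\<in>R. if X \<omega> = a then g a else 0)"
      by (intro sum.cong) (auto simp: indicator_def)
    also have "\<dots> = g (X \<omega>)"
      using assms \<omega> by auto
    finally show "g (X \<omega>) = (\<Sum>a\<in>R. g a * indicator (X -` {a} \<inter> space M) \<omega>)" ..
  qed simp
  also have "\<dots> = (\<Sum>a\<in>R. expectation (\<lambda>\<omega>. g a * indicator (X -` {a} \<inter> space M) \<omega>))"
    using sets by (intro Bochner_Integration.integral_sum) (simp add: emeasure_eq_measure)
  also have "\<dots> = (\<Sum>a\<in>R. prob (X -` {a} \<inter> space M) * g a)"
    using sets by (simp add: mult.commute)
  finally show ?thesis .
qed

text \<open>Stands in for conditional expectation: with \<open>X\<close> of finite range,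
  independence factors the joint weights, and \<open>Y\<close> is summed out separately for each
  value of \<open>X\<close>.\<close>

lemma expectation_indep_pmf_le:
  fixes X :: "'a \<Rightarrow> 'b" and Y :: "'a \<Rightarrow> 'c::finite" and h :: "'b \<Rightarrow> 'c \<Rightarrow> real"
  assumes X: "\<And>a. X -` {a} \<inter> space M \<in> events"
    and Y': "Y \<in> measurable M (count_space UNIV)"
    and indep: "\<And>a b. prob ((X -` {a} \<inter> space M) \<inter> (Y -` {b} \<inter> space M)) =
      prob (X -` {a} \<inter> space M) * prob (Y -` {b} \<inter> space M)"
    and Y: "distr M (count_space UNIV) Y = measure_pmf p"
    and fin: "finite (range X)"
    and AE: "AE \<omega> in M. (\<Sum>b\<in>UNIV. pmf p b * h (X \<omega>) b) \<le> g (X \<omega>)"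
  shows "expectation (\<lambda>\<omega>. h (X \<omega>) (Y \<omega>)) \<le> expectation (\<lambda>\<omega>. g (X \<omega>))"
proof -
  have XY: "(\<lambda>\<omega>. (X \<omega>, Y \<omega>)) -` {(a, b)} \<inter> space M = (X -` {a} \<inter> space M) \<inter> (Y -` {b} \<inter> space M)" for a b
    by auto
  have XY': "(\<lambda>\<omega>. (X \<omega>, Y \<omega>)) -` {c} \<inter> space M \<in> events" for c
    using X measurable_sets[OF Y', of "{snd c}"] by (cases c) (auto simp: XY)
  have prob_Y: "prob (Y -` {b} \<inter> space M) = pmf p b" for b
    using measure_distr[OF Y', of "{b}"] by (simp add: Y measure_pmf_single)
  have prob_XY: "prob ((\<lambda>\<omega>. (X \<omega>, Y \<omega>)) -` {(a, b)} \<inter> space M) = prob (X -` {a} \<inter> space M) * pmf p b" for a b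
    by (simp only: XY indep prob_Y)
  have "expectation (\<lambda>\<omega>. h (X \<omega>) (Y \<omega>)) =
      (\<Sum>(a, b)\<in>range X \<times> UNIV. prob (X -` {a} \<inter> space M) * pmf p b * h a b)"
    by (subst expectation_finite_range[OF XY', of "range X \<times> UNIV" "\<lambda>(a, b). h a b", simplified])
      (auto simp: prob_XY fin intro!: sum.cong)
  also have "\<dots> = (\<Sum>a\<in>range X. prob (X -` {a} \<inter> space M) * (\<Sum>b\<in>UNIV. pmf p b * h a b))"
    by (simp add: sum.cartesian_product[symmetric] sum_distrib_left mult.assoc)
  also have "\<dots> \<le> (\<Sum>a\<in>range X. prob (X -` {a} \<inter> space M) * g a)"
  proof (rule sum_mono)
    fix a
    show "prob (X -` {a} \<inter> space M) * (\<Sum>b\<in>UNIV. pmf p b * h a b) \<le> prob (X -` {a} \<inter> space M) * g a"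
    proof (cases "(\<Sum>b\<in>UNIV. pmf p b * h a b) \<le> g a")
      case True
      then show ?thesis
        by (simp add: mult_left_mono)
    next
      case False
      \<comment> \<open>A value of \<open>X\<close> at which the inequality fails is attained with
        probability zero, so its summand vanishes on both sides.\<close>
      have "AE \<omega> in M. \<omega> \<notin> X -` {a} \<inter> space M"
        using AE by eventually_elim (use False in auto)
      then have "prob (X -` {a} \<inter> space M) = 0"
        using prob_eq_0[OF X] by blast
      then show ?thesis by simp
    qed
  qed
  also have "\<dots> = expectation (\<lambda>\<omega>. g (X \<omega>))"
    by (rule expectation_finite_range[OF X fin, symmetric]) auto
  finally show ?thesis .
qed

end

section \<open>Linear convergence by iterating the one-step contraction\<close>

theorem corollary7p3:
  fixes \<phi> :: "'n::{finite,linorder} \<Rightarrow> real^'d \<Rightarrow> real"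
    and wstar w0 :: "real^'d" and \<alpha>0 :: "'n \<Rightarrow> real^'d"
    and xstar x0 :: "('d, 'n) state"
    and M :: "'a measure" and B :: "nat \<Rightarrow> 'a \<Rightarrow> 'n set"
    and x :: "nat \<Rightarrow> 'a \<Rightarrow> ('d, 'n) state"
    and \<mu> :: real
  defines "xstar \<equiv> stack wstar (\<lambda>_. wstar)"
    and "x0 \<equiv> stack w0 \<alpha>0"
    and "x \<equiv> (\<lambda>k \<omega>. snm \<phi> x0 (\<lambda>j. B j \<omega>) k)"
  assumes "\<And>i. twice_differentiable (\<phi> i)"
    and "\<And>i. strictly_convex (\<phi> i)"
    and "\<And>y. snm_F \<phi> differentiable (at y)"
    and "continuous_on UNIV (snm_DF \<phi>)"
    and "CARD('t::{finite,linorder}) \<le> CARD('n)"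
    and "prob_space M"
    and "prob_space.indep_vars M (\<lambda>_. count_space UNIV) B UNIV"
    and "\<And>k. distr M (count_space UNIV) (B k) = measure_pmf (uniform_subset CARD('t))"
    and "AE \<omega> in M. \<forall>k. invertible (avg_hessian \<phi> (x k \<omega>))"
    and "grad (avg_fun \<phi>) wstar = 0"
    and "\<mu> > 0"
    and "\<And>y x'. snm_f TYPE('t) \<phi> x' xstar \<ge>
           snm_f TYPE('t) \<phi> x' y + grad (snm_f TYPE('t) \<phi> x') y \<bullet> (xstar - y)
             + \<mu> / 2 * (norm (xstar - y))\<^sup>2"
  shows "\<forall>k. prob_space.expectation M (\<lambda>\<omega>. (norm (x (Suc k) \<omega> - xstar))\<^sup>2)
           \<le> (1 - \<mu>) ^ (Suc k) * (norm (x0 - xstar))\<^sup>2"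
proof -
  interpret prob_space M by fact
  note \<phi> = assms(4)
  define E where "E k = expectation (\<lambda>\<omega>. (norm (x k \<omega> - xstar))\<^sup>2)" for k
  have "((\<Sum>i\<in>UNIV. grad (\<phi> i) wstar) :: real^'d) = 0"
    using \<open>grad (avg_fun \<phi>) wstar = 0\<close> by (simp add: grad_avg_fun[OF \<phi>])
  then have zero: "snm_F \<phi> xstar = 0"
    by (intro state_eqI) (simp_all add: snm_F_def xstar_def)
  have inv: "AE \<omega> in M. invertible (avg_hessian \<phi> (x k \<omega>))" for k
    using assms(12) by eventually_elim simp
  have contraction: "E (Suc k) \<le> (1 - \<mu>) * E k" for k
  proof -
    have meas: "B k \<in> measurable M (count_space UNIV)"
      using assms(10) unfolding indep_vars_def by simp
    have "AE \<omega> in M. (\<Sum>b\<in>UNIV. pmf (uniform_subset CARD('t)) b * (norm (snm_step \<phi> b (x k \<omega>) - xstar))\<^sup>2)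
        \<le> (1 - \<mu>) * (norm (x k \<omega> - xstar))\<^sup>2"
      using inv[of k]
    proof eventually_elim
      \<comment> \<open>The convexity hypothesis holds at all pairs of points; here both are the
        current iterate \<open>x k \<omega>\<close>.\<close>
      case (elim \<omega>)
      show ?case
        by (rule snm_step_contraction[OF \<phi> elim _ zero assms(15)]) fact
    qed
    then have "expectation (\<lambda>\<omega>. (norm (snm_step \<phi> (B k \<omega>) (x k \<omega>) - xstar))\<^sup>2)
        \<le> expectation (\<lambda>\<omega>. (1 - \<mu>) * (norm (x k \<omega> - xstar))\<^sup>2)"
      unfolding x_def
      by (intro expectation_indep_pmf_le[OF events_snm[OF assms(10)] meas prob_snm_indep[OF assms(10)]
            assms(11) finite_range_snm, where h = "\<lambda>y b. (norm (snm_step \<phi> b y - xstar))\<^sup>2"])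
    then show ?thesis
      by (simp add: E_def x_def)
  qed
  have E_nonneg: "0 \<le> E k" for k
    by (simp add: E_def)
  have E0: "E 0 = (norm (x0 - xstar))\<^sup>2"
    by (simp add: E_def x_def prob_space)
  have "E k \<le> (1 - \<mu>) ^ k * E 0" for k
  \<comment> \<open>The induction multiplies an inequality by \<open>1 - \<mu>\<close>, which
    preserves its direction only if that factor is nonnegative.\<close>
  proof (cases "\<mu> \<le> 1")
    case True
    show ?thesis
    proof (induction k)
      case (Suc k)
      have "E (Suc k) \<le> (1 - \<mu>) * E k"
        by (rule contraction)
      also have "\<dots> \<le> (1 - \<mu>) * ((1 - \<mu>) ^ k * E 0)"
        using Suc True by (intro mult_left_mono) auto
      finally show ?case by (simp add: mult.assoc)
    qed simp
  next
    case False
    \<comment> \<open>A negative contraction factor forces every error, including the initial one, to vanish.\<close>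
    have "E j = 0" for j
      using contraction[of j] E_nonneg[of j] E_nonneg[of "Suc j"] False
      by (smt (verit) mult_neg_pos)
    then show ?thesis by simp
  qed
  then show ?thesis
    unfolding E0 by (simp only: E_def) blast
qed

end
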